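(* Let $N\in\{1,2,\dots\}$, let $(P_\theta)_{\theta\in\Theta}$ be a statistical model on $(\Omega,\mathcal{F})$, and let $(\mathcal{F}'_n)$ be a filtration with $\mathcal{F}'_n\subseteq\mathcal{F}_n$ for all $n$, where $(\mathcal{F}_n)$ is the natural filtration. Let $(S^\theta)_{\theta\in\Theta}$ be a family such that, for each $\theta\in\Theta$, $S^\theta$ is a test martingale with respect to the filtration $(\mathcal{F}'_n)$ and $P_\theta$. Then there exists a family $(\tilde S^\theta)_{\theta\in\Theta}$ of processes $\tilde S^\theta=(\tilde S^\theta_n)_{n=0}^N$ such that, for each $\theta\in\Theta$, $\tilde S^\theta$ is a natural test martingale with respect to $P_\theta$ (over the time horizon $n=0,\dots,N$), and $$\inf_{\theta\in\Theta}\tilde S^\theta_N=\inf_{\theta\in\Theta}S^\theta_N$$ everywhere on $\Omega$.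
   Context: $(\Omega,\mathcal{F})$ is a measurable space and $(P_\theta)_{\theta\in\Theta}$ is a family of probability measures on it (the statistical model), where $\Theta$ is an arbitrary nonempty set. $Z_1,Z_2,\dots$ are random elements on $(\Omega,\mathcal{F})$ with values in a measurable space $\mathbf{Z}$ (the observations). The natural filtration is $\mathcal{F}_n:=\sigma(Z_1,\dots,Z_n)$, $n=0,1,\dots$ ($\mathcal{F}_0$ is trivial). A filtration is an increasing sequence of $\sigma$-algebras. A test martingale with respect to a filtration and a probability measure $P$ is a nonnegative martingale $(S_n)$ with respect to that filtration and $P$ with $S_0=1$; it is called natural if the filtration is the natural filtration $(\mathcal{F}_n)$. No measurability in $\theta$ is assumed. *)

theory Defs
  imports "HOL-Probability.Probability"
begin

text \<open>
  The $\sigma$-algebra generated by the observations $Z_1, \dots, Z_n$ on the measurable space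
  \<open>M\<close>, with values in the measurable space \<open>N\<close>. Observations are indexed from 1;
  \<open>Z 0\<close> plays no role. Only the space and the measurable sets of \<open>M\<close>, \<open>N\<close> and of
  the resulting measure object are meaningful.
\<close>
definition natural_filtration ::
    "'a measure \<Rightarrow> 'z measure \<Rightarrow> (nat \<Rightarrow> 'a \<Rightarrow> 'z) \<Rightarrow> nat \<Rightarrow> 'a measure" where
  "natural_filtration M N Z n =
     sigma (space M) {Z i -` A \<inter> space M | i A. i \<in> {1..n} \<and> A \<in> sets N}"

text \<open>
  Martingale over the time set \<open>T\<close> (all of \<open>UNIV\<close>, or \<open>{..N}\<close> for a finite horizon
  $n = 0, \dots, N$); the values of \<open>X\<close> at times outside \<open>T\<close> are irrelevant.
\<close>
definition martingale ::
    "nat set \<Rightarrow> 'a measure \<Rightarrow> (nat \<Rightarrow> 'a measure) \<Rightarrow> (nat \<Rightarrow> 'a \<Rightarrow> real) \<Rightarrow> bool" where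
  "martingale T P F X \<longleftrightarrow>
     filtration (space P) F \<and> (\<forall>n. subalgebra P (F n)) \<and>
     (\<forall>n\<in>T. X n \<in> borel_measurable (F n)) \<and>
     (\<forall>n\<in>T. integrable P (X n)) \<and>
     (\<forall>m\<in>T. \<forall>n\<in>T. m \<le> n \<longrightarrow> (AE \<omega> in P. real_cond_exp P (F m) (X n) \<omega> = X m \<omega>))"

text \<open>Nonnegativity and the initial condition hold everywhere, not just almost surely.\<close>
definition test_martingale ::
    "nat set \<Rightarrow> 'a measure \<Rightarrow> (nat \<Rightarrow> 'a measure) \<Rightarrow> (nat \<Rightarrow> 'a \<Rightarrow> real) \<Rightarrow> bool" where
  "test_martingale T P F S \<longleftrightarrow>
     martingale T P F S \<and>
     (\<forall>n\<in>T. \<forall>\<omega>\<in>space P. 0 \<le> S n \<omega>) \<and>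
     (\<forall>\<omega>\<in>space P. S 0 \<omega> = 1)"

lemma space_natural_filtration [simp]: "space (natural_filtration M N Z n) = space M"
  unfolding natural_filtration_def by (rule space_measure_of) auto

lemma sets_natural_filtration:
  "sets (natural_filtration M N Z n) =
     sigma_sets (space M) {Z i -` A \<inter> space M | i A. i \<in> {1..n} \<and> A \<in> sets N}"
  unfolding natural_filtration_def by (rule sets_measure_of) auto

lemma sets_natural_filtration_0: "sets (natural_filtration M N Z 0) = {{}, space M}"
  by (simp add: sets_natural_filtration sigma_sets_empty_eq)

lemma filtration_natural_filtration: "filtration (space M) (natural_filtration M N Z)"
proof
  fix i j :: nat assume "i \<le> j"
  then show "sets (natural_filtration M N Z i) \<le> sets (natural_filtration M N Z j)"
    unfolding sets_natural_filtration by (intro sigma_sets_mono') fastforce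
qed simp

lemma subalgebra_natural_filtration:
  assumes "\<And>i. 1 \<le> i \<Longrightarrow> Z i \<in> measurable M N"
  shows "subalgebra M (natural_filtration M N Z n)"
  unfolding subalgebra_def sets_natural_filtration
  by (auto intro!: sets.sigma_sets_subset measurable_sets[OF assms])

end

theory Submission
  imports Defs
begin

text \<open>
  Of each test martingale $S^\theta$ for the coarser filtration only the terminal value $S^\theta_N$
  matters. It is nonnegative, has expectation 1 under $P_\theta$, and is measurable with respect to
  $\mathcal{F}'_N \subseteq \mathcal{F}_N$. Such a variable is the terminal value of a natural test
  martingale, namely the Doob martingale $\mathbb{E}_\theta(S^\theta_N \mid \mathcal{F}_n)$. Replacing
  $S^\theta$ by it, separately for each $\theta$, leaves the terminal values unchanged, and hence their
  infimum too.

  The only delicate point is that a test martingale is nonnegative and starts from 1 everywhere, and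
  that the final values have to agree everywhere, whereas conditional expectations are determined
  only almost surely. The versions are therefore chosen by hand: the constant 1 at time 0, which is
  legitimate because the natural $\sigma$-algebra at time 0 is trivial; the variable itself at time
  \<open>N\<close>, which is legitimate because it is measurable there; and the positive part of any
  version in between. Lemma \<open>test_martingale_with_terminal_value\<close> carries this out.
\<close>

lemma (in prob_space) real_cond_exp_trivial:
  fixes f :: "'a \<Rightarrow> real"
  assumes G: "subalgebra M G" and trivial: "sets G = {{}, space M}" and f: "integrable M f"
  shows "AE x in M. real_cond_exp M G f x = expectation f"
proof -
  interpret finite_measure_subalgebra M G
    by unfold_locales (rule G)
  have "(LINT x:A|M. f x) = (LINT x:A|M. expectation f)" if "A \<in> sets G" for A
    using that trivial set_integral_space[OF f]
      set_integral_space[of M "\<lambda>_. expectation f"]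
    by (auto simp: prob_space set_lebesgue_integral_def[of _ "{}"])
  then show ?thesis
    by (rule real_cond_exp_charact) (use f in auto)
qed

text \<open>
  The Doob martingale of \<open>f\<close> is modified on null sets so that nonnegativity, the initial
  condition and the terminal condition hold pointwise. Triviality at time 0 and expectation 1 make
  the constant 1 a version of the conditional expectation there; a positive horizon keeps the
  prescriptions at times 0 and \<open>N\<close> from conflicting.
\<close>
lemma (in prob_space) test_martingale_with_terminal_value:
  fixes f :: "'a \<Rightarrow> real"
  assumes N: "N \<ge> 1"
    and filt: "filtration (space M) F"
    and sub: "\<And>n. subalgebra M (F n)"
    and trivial: "sets (F 0) = {{}, space M}"
    and f_meas: "f \<in> borel_measurable (F N)"
    and f_int: "integrable M f"
    and f_nonneg: "\<And>x. x \<in> space M \<Longrightarrow> 0 \<le> f x"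
    and f_exp: "expectation f = 1"
  shows "\<exists>X. test_martingale {..N} M F X \<and> X N = f"
proof -
  have sfs: "sigma_finite_subalgebra M (F n)" for n
    by (intro finite_measure_subalgebra_is_sigma_finite finite_measure_subalgebra.intro
        finite_measure_subalgebra_axioms.intro sub) unfold_locales
  define X where "X n = (if n = 0 then \<lambda>_. 1 else if n = N then f
                         else (\<lambda>x. max 0 (real_cond_exp M (F n) f x)))" for n
  have X_meas: "X n \<in> borel_measurable (F n)" for n
    using f_meas by (auto simp: X_def)
  have X_version: "AE x in M. real_cond_exp M (F n) f x = X n x" for n
  proof -
    interpret sigma_finite_subalgebra M "F n" by (rule sfs)
    consider "n = 0" | "n \<noteq> 0" "n = N" | "n \<noteq> 0" "n \<noteq> N" by blast
    then show ?thesis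
    proof cases
      case 1
      then show ?thesis
        using real_cond_exp_trivial[OF sub trivial f_int] f_exp by (simp add: X_def)
    next
      case 2
      then show ?thesis
        using real_cond_exp_F_meas[OF f_int] f_meas by (simp add: X_def)
    next
      case 3
      have "AE x in M. 0 \<le> real_cond_exp M (F n) f x"
        using f_int f_nonneg by (intro real_cond_exp_pos) auto
      then show ?thesis
        using 3 by (auto simp: X_def)
    qed
  qed
  have X_meas_M: "X n \<in> borel_measurable M" for n
    using X_meas measurable_from_subalg[OF sub] by blast
  have X_int: "integrable M (X n)" for n
  proof -
    interpret sigma_finite_subalgebra M "F n" by (rule sfs)
    show ?thesis
      using integrable_cong_AE_imp[OF real_cond_exp_int(1)[OF f_int] X_meas_M] X_version[of n]
      by auto
  qed
  have X_martingale: "AE x in M. real_cond_exp M (F m) (X n) x = X m x" if "m \<le> n" for m n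
  proof -
    interpret sigma_finite_subalgebra M "F m" by (rule sfs)
    have "subalgebra (F n) (F m)"
      using filt that sub
      by (auto simp: subalgebra_def filtration_def)
    then have "AE x in M. real_cond_exp M (F m) (real_cond_exp M (F n) f) x
                 = real_cond_exp M (F m) f x"
      using real_cond_exp_nested_subalg[OF sub _ f_int] by blast
    moreover have "AE x in M. real_cond_exp M (F m) (real_cond_exp M (F n) f) x
                     = real_cond_exp M (F m) (X n) x"
      by (rule real_cond_exp_cong[OF X_version])
        (use X_meas_M measurable_from_subalg[OF sub borel_measurable_cond_exp] in auto)
    ultimately show ?thesis
      using X_version[of m] by auto
  qed
  have "test_martingale {..N} M F X"
    unfolding test_martingale_def martingale_def
    using filt sub X_meas X_int X_martingale f_nonneg by (auto simp: X_def)
  moreover have "X N = f"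
    using N by (simp add: X_def)
  ultimately show ?thesis by blast
qed

lemma (in prob_space) test_martingale_expectation:
  assumes S: "test_martingale T M F S" and T: "0 \<in> T" "n \<in> T"
  shows "expectation (S n) = 1"
proof -
  have sub: "subalgebra M (F 0)" and int: "integrable M (S n)"
    and mart: "AE x in M. real_cond_exp M (F 0) (S n) x = S 0 x"
    and init: "\<And>x. x \<in> space M \<Longrightarrow> S 0 x = 1"
    using S T by (auto simp: test_martingale_def martingale_def)
  interpret finite_measure_subalgebra M "F 0"
    by unfold_locales (rule sub)
  have "expectation (S n) = expectation (real_cond_exp M (F 0) (S n))"
    by (rule real_cond_exp_int(2)[OF int, symmetric])
  also have "\<dots> = expectation (\<lambda>_. 1)"
    by (rule integral_cong_AE)
      (use mart init measurable_from_subalg[OF sub borel_measurable_cond_exp] in auto)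
  finally show ?thesis by (simp add: prob_space)
qed

theorem proposition6p1:
  fixes M :: "'a measure" and Zs :: "'z measure" and Z :: "nat \<Rightarrow> 'a \<Rightarrow> 'z"
    and \<Theta> :: "'t set" and P :: "'t \<Rightarrow> 'a measure"
    and F' :: "nat \<Rightarrow> 'a measure" and S :: "'t \<Rightarrow> nat \<Rightarrow> 'a \<Rightarrow> real" and N :: nat
  assumes "N \<ge> 1"
    and "\<Theta> \<noteq> {}"
    and "\<And>\<theta>. \<theta> \<in> \<Theta> \<Longrightarrow> prob_space (P \<theta>)"
    and "\<And>\<theta>. \<theta> \<in> \<Theta> \<Longrightarrow> sets (P \<theta>) = sets M"
    and "\<And>i. i \<ge> 1 \<Longrightarrow> Z i \<in> measurable M Zs"
    and "filtration (space M) F'"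
    and "\<And>n. sets (F' n) \<subseteq> sets (natural_filtration M Zs Z n)"
    and "\<And>\<theta>. \<theta> \<in> \<Theta> \<Longrightarrow> test_martingale UNIV (P \<theta>) F' (S \<theta>)"
  shows "\<exists>S' :: 't \<Rightarrow> nat \<Rightarrow> 'a \<Rightarrow> real.
    (\<forall>\<theta>\<in>\<Theta>. test_martingale {..N} (P \<theta>) (natural_filtration M Zs Z) (S' \<theta>)) \<and>
    (\<forall>\<omega>\<in>space M. (INF \<theta>\<in>\<Theta>. S' \<theta> N \<omega>) = (INF \<theta>\<in>\<Theta>. S \<theta> N \<omega>))"
proof -
  let ?F = "natural_filtration M Zs Z"
  have "\<exists>X. test_martingale {..N} (P \<theta>) ?F X \<and> X N = S \<theta> N" if \<theta>: "\<theta> \<in> \<Theta>" for \<theta>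
  proof -
    interpret prob_space "P \<theta>" by (rule assms(3)[OF \<theta>])
    have S: "test_martingale UNIV (P \<theta>) F' (S \<theta>)" by (rule assms(8)[OF \<theta>])
    have sets_P: "sets (P \<theta>) = sets M" by (rule assms(4)[OF \<theta>])
    then have space_P: "space (P \<theta>) = space M" by (rule sets_eq_imp_space_eq)
    have "subalgebra (?F N) (F' N)"
      using assms(6,7) by (auto simp: subalgebra_def filtration_def)
    then have "S \<theta> N \<in> borel_measurable (?F N)"
      by (rule measurable_from_subalg)
        (use S in \<open>simp add: test_martingale_def martingale_def\<close>)
    moreover have "subalgebra (P \<theta>) (?F n)" for n
      using subalgebra_natural_filtration[of Z M Zs n] assms(5) sets_P space_P
      by (simp add: subalgebra_def)
    ultimately show ?thesis
      using S assms(1) test_martingale_expectation[OF S]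
      by (intro test_martingale_with_terminal_value)
        (auto simp: space_P filtration_natural_filtration sets_natural_filtration_0
          test_martingale_def martingale_def)
  qed
  then obtain S' where S': "\<And>\<theta>. \<theta> \<in> \<Theta> \<Longrightarrow> test_martingale {..N} (P \<theta>) ?F (S' \<theta>)"
    "\<And>\<theta>. \<theta> \<in> \<Theta> \<Longrightarrow> S' \<theta> N = S \<theta> N"
    by metis
  then have "(INF \<theta>\<in>\<Theta>. S' \<theta> N \<omega>) = (INF \<theta>\<in>\<Theta>. S \<theta> N \<omega>)" for \<omega>
    by simp
  with S'(1) show ?thesis by blast
qed

end
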